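(* Let $d\ge1$ and, for $u_0\in\mathcal{M}_{\rm loc}(\mathbb{R}^d)$, let $$u(x,t)=\frac{1}{(4\pi t)^{d/2}}\int_{\mathbb{R}^d}e^{-|x-y|^2/4t}\,\mathrm{d}u_0(y).$$ If $u_0\in\mathcal{M}_0(\mathbb{R}^d)$ then $u(x,t)$ is well defined (the integral converges absolutely) for all $x\in\mathbb{R}^d$ and $t>0$; in particular $u(t)\in L^1_0(\mathbb{R}^d)$ for every $t>0$. Conversely, if $u_0\in\mathcal{M}_{\rm loc}(\mathbb{R}^d)$ with $u_0\ge0$ and $u(x,t)$ is defined (i.e. finite, for $x\in\mathbb{R}^d$) for all $t>0$, then $u_0\in\mathcal{M}_0(\mathbb{R}^d)$.
   Context: $\mathcal{M}_{\rm loc}(\mathbb{R}^d)$ is the set of (signed) Radon measures on $\mathbb{R}^d$, identified with the dual of $C_c(\mathbb{R}^d)$; $|\mu|=\mu^++\mu^-$ is the total variation measure. For $\varepsilon>0$, $\mathcal{M}_\varepsilon(\mathbb{R}^d)=\{\mu\in\mathcal{M}_{\rm loc}(\mathbb{R}^d):\int e^{-\varepsilon|x|^2}\,\mathrm{d}|\mu|(x)<\infty\}$ and $L^1_\varepsilon(\mathbb{R}^d)=\{f\in L^1_{\rm loc}(\mathbb{R}^d):\int e^{-\varepsilon|x|^2}|f(x)|\,\mathrm{d}x<\infty\}$. Set $\mathcal{M}_0(\mathbb{R}^d)=\bigcap_{\varepsilon>0}\mathcal{M}_\varepsilon(\mathbb{R}^d)$ and $L^1_0(\mathbb{R}^d)=\bigcap_{\varepsilon>0}L^1_\varepsilon(\mathbb{R}^d)$.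 Write $u(t)=u(\cdot,t)$. *)

theory Defs
  imports "HOL-Analysis.Analysis"
begin

text \<open>
  A signed Radon measure need not have a value on unbounded sets (its positive and its negative
  part may both be infinite there), so it is modelled as a real-valued set function on the
  bounded Borel sets which is countably additive there. On a Euclidean space regularity is
  automatic. The value outside the bounded Borel sets is fixed to \<open>undefined\<close>, so that
  equality in \<open>M_loc\<close> is equality of Radon measures.
\<close>

definition bounded_borel :: "'a::euclidean_space set set" where
  "bounded_borel = {A \<in> sets borel. bounded A}"

definition additive_bb :: "('a::euclidean_space set \<Rightarrow> real) \<Rightarrow> bool" where
  "additive_bb \<mu> \<longleftrightarrow> (\<forall>A :: nat \<Rightarrow> 'a set.
     range A \<subseteq> bounded_borel \<and> disjoint_family A \<and> bounded (\<Union>i. A i)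
       \<longrightarrow> (\<lambda>i. \<mu> (A i)) sums \<mu> (\<Union>i. A i))"

definition M_loc :: "('a::euclidean_space set \<Rightarrow> real) set" where
  "M_loc = {\<mu> \<in> extensional bounded_borel. additive_bb \<mu>}"

definition nonneg_measure :: "('a::euclidean_space set \<Rightarrow> real) \<Rightarrow> bool" where
  "nonneg_measure \<mu> \<longleftrightarrow> (\<forall>A \<in> bounded_borel. 0 \<le> \<mu> A)"

text \<open>
  The positive part is \<open>\<mu>\<^sup>+(A) = sup {\<mu>(B). B \<subseteq> A}\<close>, with \<open>B\<close> ranging over bounded Borel sets;
  the truncation in \<open>ennreal\<close> is harmless because \<open>B = {}\<close> is allowed. That these set functions
  are indeed measures, finite on bounded sets and with \<open>\<mu> = \<mu>\<^sup>+ - \<mu>\<^sup>-\<close>, is shown below.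
\<close>

definition pos_part_fun :: "('a::euclidean_space set \<Rightarrow> real) \<Rightarrow> 'a set \<Rightarrow> ennreal" where
  "pos_part_fun \<mu> A = (SUP B \<in> {B \<in> bounded_borel. B \<subseteq> A}. ennreal (\<mu> B))"

definition pos_part :: "('a::euclidean_space set \<Rightarrow> real) \<Rightarrow> 'a measure" where
  "pos_part \<mu> = measure_of UNIV (sets borel) (pos_part_fun \<mu>)"

definition neg_part :: "('a::euclidean_space set \<Rightarrow> real) \<Rightarrow> 'a measure" where
  "neg_part \<mu> = pos_part (\<lambda>A. - \<mu> A)"

definition total_variation :: "('a::euclidean_space set \<Rightarrow> real) \<Rightarrow> 'a measure" where
  "total_variation \<mu> = measure_of UNIV (sets borel)
     (\<lambda>A. emeasure (pos_part \<mu>) A + emeasure (neg_part \<mu>) A)"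

text \<open>Meaningful only if \<open>f\<close> is integrable with respect to \<open>total_variation \<mu>\<close>.\<close>

definition signed_integral :: "('a::euclidean_space set \<Rightarrow> real) \<Rightarrow> ('a \<Rightarrow> real) \<Rightarrow> real" where
  "signed_integral \<mu> f = (\<integral>y. f y \<partial>pos_part \<mu>) - (\<integral>y. f y \<partial>neg_part \<mu>)"

definition M_eps :: "real \<Rightarrow> ('a::euclidean_space set \<Rightarrow> real) set" where
  "M_eps \<epsilon> = {\<mu> \<in> M_loc. (\<integral>\<^sup>+x. ennreal (exp (- \<epsilon> * (norm x)\<^sup>2)) \<partial>total_variation \<mu>) < \<infinity>}"

definition M_0 :: "('a::euclidean_space set \<Rightarrow> real) set" where
  "M_0 = (\<Inter>\<epsilon> \<in> {0<..}. M_eps \<epsilon>)"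

definition L1_loc :: "('a::euclidean_space \<Rightarrow> real) set" where
  "L1_loc = {f. \<forall>K. compact K \<longrightarrow> f absolutely_integrable_on K}"

definition L1_eps :: "real \<Rightarrow> ('a::euclidean_space \<Rightarrow> real) set" where
  "L1_eps \<epsilon> = {f \<in> L1_loc.
     (\<integral>\<^sup>+x. ennreal (exp (- \<epsilon> * (norm x)\<^sup>2) * \<bar>f x\<bar>) \<partial>lebesgue) < \<infinity>}"

definition L1_0 :: "('a::euclidean_space \<Rightarrow> real) set" where
  "L1_0 = (\<Inter>\<epsilon> \<in> {0<..}. L1_eps \<epsilon>)"

definition heat_defined :: "('a::euclidean_space set \<Rightarrow> real) \<Rightarrow> 'a \<Rightarrow> real \<Rightarrow> bool" where
  "heat_defined u0 x t \<longleftrightarrow>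
     integrable (total_variation u0) (\<lambda>y. exp (- (norm (x - y))\<^sup>2 / (4 * t)))"

definition heat :: "('a::euclidean_space set \<Rightarrow> real) \<Rightarrow> 'a \<Rightarrow> real \<Rightarrow> real" where
  "heat u0 x t = 1 / (4 * pi * t) powr (DIM('a) / 2)
     * signed_integral u0 (\<lambda>y. exp (- (norm (x - y))\<^sup>2 / (4 * t)))"


lemma bounded_borelI: "A \<in> sets borel \<Longrightarrow> B \<in> bounded_borel \<Longrightarrow> A \<subseteq> B \<Longrightarrow> A \<in> bounded_borel"
  by (auto simp: bounded_borel_def intro: bounded_subset)

lemma bounded_borel_empty [simp]: "{} \<in> bounded_borel"
  by (simp add: bounded_borel_def)

lemma M_loc_additive: "\<mu> \<in> M_loc \<Longrightarrow> additive_bb \<mu>"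
  by (simp add: M_loc_def)

lemma additive_bb_minus: "additive_bb \<mu> \<Longrightarrow> additive_bb (\<lambda>A. - \<mu> A)"
  unfolding additive_bb_def using sums_minus by blast

lemma additive_bb_empty:
  assumes "additive_bb \<mu>" shows "\<mu> {} = 0"
proof -
  have "(\<lambda>i::nat. \<mu> {}) sums \<mu> (\<Union>i::nat. {})"
    using assms[unfolded additive_bb_def, rule_format, of "\<lambda>_. {}"]
    by (auto simp: disjoint_family_on_def)
  then have "(\<lambda>i::nat. \<mu> {}) \<longlonglongrightarrow> 0"
    using summable_LIMSEQ_zero sums_summable by blast
  then show ?thesis using LIMSEQ_unique tendsto_const by blast
qed

lemma additive_bb_Un:
  assumes "additive_bb \<mu>" "A \<in> bounded_borel" "B \<in> bounded_borel" "A \<inter> B = {}"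
  shows "\<mu> (A \<union> B) = \<mu> A + \<mu> B"
proof -
  let ?F = "\<lambda>i::nat. if i = 0 then A else if i = 1 then B else {}"
  have U: "(\<Union>i. ?F i) = A \<union> B" by (auto split: if_splits)
  have "range ?F \<subseteq> bounded_borel" "disjoint_family ?F" "bounded (\<Union>i. ?F i)"
    unfolding U using assms(2-4) by (auto simp: disjoint_family_on_def bounded_borel_def)
  then have "(\<lambda>i. \<mu> (?F i)) sums \<mu> (\<Union>i. ?F i)"
    using assms(1) unfolding additive_bb_def by blast
  moreover have "(\<lambda>i. \<mu> (?F i)) sums (\<Sum>i\<in>{0,1}. \<mu> (?F i))"
    by (rule sums_finite) (auto simp: additive_bb_empty[OF assms(1)])
  ultimately show ?thesis using U sums_unique2 by fastforce
qed

lemma pos_part_fun_upper: "B \<in> bounded_borel \<Longrightarrow> B \<subseteq> A \<Longrightarrow> ennreal (\<mu> B) \<le> pos_part_fun \<mu> A"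
  unfolding pos_part_fun_def by (rule SUP_upper) auto

lemma pos_part_fun_mono: "A \<subseteq> B \<Longrightarrow> pos_part_fun \<mu> A \<le> pos_part_fun \<mu> B"
  unfolding pos_part_fun_def by (rule SUP_subset_mono) auto

lemma pos_part_fun_super:
  assumes "additive_bb \<mu>" "A \<inter> B = {}"
  shows "pos_part_fun \<mu> A + pos_part_fun \<mu> B \<le> pos_part_fun \<mu> (A \<union> B)"
proof -
  have *: "ennreal (\<mu> C) + ennreal (\<mu> D) \<le> pos_part_fun \<mu> (A \<union> B)"
    if CD: "C \<in> bounded_borel" "C \<subseteq> A" "D \<in> bounded_borel" "D \<subseteq> B" for C D
  proof -
    have "C \<inter> D = {}" "C \<union> D \<in> bounded_borel"
      using CD assms(2) by (auto simp: bounded_borel_def)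
    then have "ennreal (\<mu> C + \<mu> D) \<le> pos_part_fun \<mu> (A \<union> B)"
      using pos_part_fun_upper[of "C \<union> D" "A \<union> B" \<mu>] additive_bb_Un[OF assms(1), of C D] CD by auto
    moreover have "ennreal (\<mu> C) \<le> pos_part_fun \<mu> (A \<union> B)" "ennreal (\<mu> D) \<le> pos_part_fun \<mu> (A \<union> B)"
      using pos_part_fun_upper CD by (metis le_supI1 le_supI2)+
    ultimately show ?thesis
      by (cases "\<mu> C \<ge> 0"; cases "\<mu> D \<ge> 0") (auto simp: ennreal_neg ennreal_plus)
  qed
  let ?S = "\<lambda>A. {B \<in> bounded_borel. B \<subseteq> A}"
  have ne: "?S X \<noteq> {}" for X :: "'a set" using bounded_borel_empty by blast
  have "pos_part_fun \<mu> A + pos_part_fun \<mu> B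
      = (SUP D\<in>?S B. SUP C\<in>?S A. ennreal (\<mu> C) + ennreal (\<mu> D))"
    unfolding pos_part_fun_def ennreal_SUP_add_left[OF ne, symmetric]
      ennreal_SUP_add_right[OF ne] ..
  also have "\<dots> \<le> pos_part_fun \<mu> (A \<union> B)"
    by (intro SUP_least) (use * in blast)
  finally show ?thesis .
qed

lemma pos_part_fun_empty: "additive_bb \<mu> \<Longrightarrow> pos_part_fun \<mu> {} = 0"
  by (simp add: pos_part_fun_def additive_bb_empty cong: conj_cong)

lemma pos_part_fun_countably_additive:
  assumes "additive_bb \<mu>"
  shows "countably_additive (sets borel) (pos_part_fun \<mu>)"
  unfolding countably_additive_def
proof (intro allI impI antisym)
  fix A :: "nat \<Rightarrow> 'a set"
  assume A: "range A \<subseteq> sets borel" "disjoint_family A"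
  have "(\<Sum>i<n. pos_part_fun \<mu> (A i)) \<le> pos_part_fun \<mu> (\<Union>i<n. A i)" for n
  proof (induction n)
    case (Suc n)
    have "(\<Sum>i<Suc n. pos_part_fun \<mu> (A i))
        \<le> pos_part_fun \<mu> (\<Union>i<n. A i) + pos_part_fun \<mu> (A n)"
      unfolding sum.lessThan_Suc by (rule add_right_mono[OF Suc.IH])
    also have "\<dots> \<le> pos_part_fun \<mu> ((\<Union>i<n. A i) \<union> A n)"
      using A(2) by (intro pos_part_fun_super[OF assms])
        (auto simp: disjoint_family_on_def dest: less_imp_neq)
    also have "(\<Union>i<n. A i) \<union> A n = (\<Union>i<Suc n. A i)"
      by (auto simp: lessThan_Suc)
    finally show ?case .
  qed simp
  moreover have "pos_part_fun \<mu> (\<Union>i<n. A i) \<le> pos_part_fun \<mu> (\<Union>i. A i)" for n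
    by (rule pos_part_fun_mono) auto
  ultimately show "(\<Sum>i. pos_part_fun \<mu> (A i)) \<le> pos_part_fun \<mu> (\<Union>i. A i)"
    by (intro suminf_le_const summableI) (meson order_trans)
  show "pos_part_fun \<mu> (\<Union>i. A i) \<le> (\<Sum>i. pos_part_fun \<mu> (A i))"
    unfolding pos_part_fun_def[of \<mu> "\<Union>i. A i"]
  proof (rule SUP_least, clarify)
    fix B :: "'a set" assume B: "B \<in> bounded_borel" "B \<subseteq> (\<Union>i. A i)"
    let ?C = "\<lambda>i. B \<inter> A i"
    have U: "(\<Union>i. ?C i) = B" using B by auto
    have C: "?C i \<in> bounded_borel" for i
      using A B by - (rule bounded_borelI[of "?C i" B], auto simp: bounded_borel_def)
    then have "range ?C \<subseteq> bounded_borel" "disjoint_family ?C" "bounded (\<Union>i. ?C i)"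
      unfolding U using A(2) B by (auto simp: disjoint_family_on_def bounded_borel_def)
    then have "(\<lambda>i. \<mu> (?C i)) sums \<mu> (\<Union>i. ?C i)"
      using assms unfolding additive_bb_def by blast
    then have lim: "(\<lambda>n. ennreal (\<Sum>i<n. \<mu> (?C i))) \<longlonglongrightarrow> ennreal (\<mu> B)"
      unfolding U sums_def by (rule tendsto_ennrealI)
    have "ennreal (\<Sum>i<n. \<mu> (?C i)) \<le> (\<Sum>i. pos_part_fun \<mu> (A i))" for n
    proof -
      have "ennreal (\<Sum>i<n. \<mu> (?C i)) \<le> ennreal (\<Sum>i<n. max 0 (\<mu> (?C i)))"
        by (intro ennreal_leI sum_mono) simp
      also have "\<dots> = (\<Sum>i<n. ennreal (\<mu> (?C i)))"
        by (rule trans[OF sum_ennreal[symmetric]], simp, rule sum.cong[OF refl])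
             (simp add: max_def ennreal_neg)
      also have "\<dots> \<le> (\<Sum>i<n. pos_part_fun \<mu> (A i))"
        by (intro sum_mono pos_part_fun_upper C) auto
      also have "\<dots> \<le> (\<Sum>i. pos_part_fun \<mu> (A i))"
        by (intro sum_le_suminf summableI) auto
      finally show ?thesis .
    qed
    then show "ennreal (\<mu> B) \<le> (\<Sum>i. pos_part_fun \<mu> (A i))"
      using LIMSEQ_le_const2[OF lim] by blast
  qed
qed

lemma sets_pos_part [simp, measurable_cong]: "sets (pos_part \<mu>) = sets borel"
  and sets_neg_part [simp, measurable_cong]: "sets (neg_part \<mu>) = sets borel"
  and sets_total_variation [simp, measurable_cong]: "sets (total_variation \<mu>) = sets borel"
  using sets.sigma_sets_eq[of borel]
  by (simp_all add: pos_part_def neg_part_def total_variation_def)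

lemma sigma_algebra_borel: "sigma_algebra UNIV (sets borel)"
  using sets.sigma_algebra_axioms[of borel] by simp

lemma emeasure_pos_part:
  assumes "additive_bb \<mu>" "A \<in> sets borel"
  shows "emeasure (pos_part \<mu>) A = pos_part_fun \<mu> A"
  unfolding pos_part_def
  using assms pos_part_fun_countably_additive[OF assms(1)] pos_part_fun_empty[OF assms(1)]
  by (intro emeasure_measure_of_sigma sigma_algebra_borel) (auto simp: positive_def)

lemma emeasure_neg_part:
  assumes "additive_bb \<mu>" "A \<in> sets borel"
  shows "emeasure (neg_part \<mu>) A = pos_part_fun (\<lambda>A. - \<mu> A) A"
  unfolding neg_part_def by (intro emeasure_pos_part additive_bb_minus assms)

lemma emeasure_total_variation:
  assumes "A \<in> sets borel"
  shows "emeasure (total_variation \<mu>) A = emeasure (pos_part \<mu>) A + emeasure (neg_part \<mu>) A"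
  unfolding total_variation_def
proof (intro emeasure_measure_of_sigma sigma_algebra_borel assms)
  show "countably_additive (sets borel) (\<lambda>A. emeasure (pos_part \<mu>) A + emeasure (neg_part \<mu>) A)"
    unfolding countably_additive_def
    by (auto simp: suminf_add[symmetric] summableI suminf_emeasure)
qed (simp add: positive_def)

text \<open>Finiteness: if \<open>\<mu>\<close> is unbounded on the Borel subsets of a bounded set, that set splits into a
  piece of \<open>\<mu>\<close>-value larger than 1 in modulus and a piece where \<open>\<mu>\<close> is again unbounded; iterating
  contradicts convergence of \<open>\<Sum>i. \<mu> (F i)\<close> over the disjoint pieces \<open>F i\<close> split off.\<close>

lemma additive_bb_bounded:
  assumes \<mu>: "additive_bb \<mu>" and E: "E \<in> bounded_borel"
  shows "\<exists>c. \<forall>B \<in> bounded_borel. B \<subseteq> E \<longrightarrow> \<bar>\<mu> B\<bar> \<le> c"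
proof (rule ccontr)
  assume nE: "\<nexists>c. \<forall>B \<in> bounded_borel. B \<subseteq> E \<longrightarrow> \<bar>\<mu> B\<bar> \<le> c"
  define unb where "unb = (\<lambda>E. E \<in> bounded_borel \<and> \<not> (\<exists>c. \<forall>B \<in> bounded_borel. B \<subseteq> E \<longrightarrow> \<bar>\<mu> B\<bar> \<le> c))"
  have split: "\<exists>D. unb D \<and> D \<subseteq> C \<and> \<bar>\<mu> (C - D)\<bar> > 1" if C: "unb C" for C
  proof -
    obtain B where B: "B \<in> bounded_borel" "B \<subseteq> C" "\<bar>\<mu> B\<bar> > \<bar>\<mu> C\<bar> + 1"
      using C unfolding unb_def by (meson not_le)
    have CB: "C - B \<in> bounded_borel"
      using B C by - (rule bounded_borelI[of _ C], auto simp: unb_def bounded_borel_def)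
    have eq: "\<mu> C = \<mu> B + \<mu> (C - B)"
      using additive_bb_Un[OF \<mu> B(1) CB] B(2) by (simp add: Un_absorb1)
    have "unb B \<or> unb (C - B)"
    proof (rule ccontr)
      assume "\<not> ?thesis"
      then have "\<not> unb B" "\<not> unb (C - B)" by simp_all
      then obtain c d where c: "\<forall>A \<in> bounded_borel. A \<subseteq> B \<longrightarrow> \<bar>\<mu> A\<bar> \<le> c"
        and d: "\<forall>A \<in> bounded_borel. A \<subseteq> C - B \<longrightarrow> \<bar>\<mu> A\<bar> \<le> d"
        using B(1) CB unfolding unb_def by meson
      have "\<bar>\<mu> A\<bar> \<le> c + d" if A: "A \<in> bounded_borel" "A \<subseteq> C" for A
      proof -
        have i: "A \<inter> B \<in> bounded_borel" "A - B \<in> bounded_borel"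
          using A(1) B(1) by (auto simp: bounded_borel_def intro: bounded_subset)
        have "\<mu> A = \<mu> (A \<inter> B) + \<mu> (A - B)"
          using additive_bb_Un[OF \<mu> i] by (simp add: Int_Diff_Un Int_Diff_disjoint)
        moreover have "\<bar>\<mu> (A \<inter> B)\<bar> \<le> c" "\<bar>\<mu> (A - B)\<bar> \<le> d"
          using i A c[rule_format, of "A \<inter> B"] d[rule_format, of "A - B"] by auto
        ultimately show ?thesis by linarith
      qed
      then show False using C unfolding unb_def by blast
    qed
    then show ?thesis
    proof
      assume "unb B" then show ?thesis using B eq by (intro exI[of _ B]) auto
    next
      assume u: "unb (C - B)"
      have "C - (C - B) = B" using B by auto
      then show ?thesis using B u by (intro exI[of _ "C - B"]) auto
    qed
  qed
  have "unb E" using nE E unfolding unb_def by blast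
  then have "\<exists>D. \<forall>n::nat. unb (D n) \<and> (D (Suc n) \<subseteq> D n \<and> \<bar>\<mu> (D n - D (Suc n))\<bar> > 1)"
    using dependent_nat_choice[of "\<lambda>_. unb" "\<lambda>_ C D. D \<subseteq> C \<and> \<bar>\<mu> (C - D)\<bar> > 1"] split by blast
  then obtain D where D: "\<And>n::nat. unb (D n)" "\<And>n. D (Suc n) \<subseteq> D n"
      "\<And>n. \<bar>\<mu> (D n - D (Suc n))\<bar> > 1" by blast
  have dec: "D n \<subseteq> D m" if "m \<le> n" for m n
    using that D(2) by (rule lift_Suc_antimono_le[rotated])
  let ?F = "\<lambda>n. D n - D (Suc n)"
  have "?F n \<in> bounded_borel" for n
    using D(1)[of n] D(1)[of "Suc n"]
    by - (rule bounded_borelI[of _ "D n"], auto simp: unb_def bounded_borel_def)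
  moreover have "disjoint_family ?F"
    unfolding disjoint_family_on_def
  proof (intro ballI impI)
    fix m n :: nat assume "m \<noteq> n"
    then consider "Suc m \<le> n" | "Suc n \<le> m" by linarith
    then show "?F m \<inter> ?F n = {}" by cases (use dec in blast)+
  qed
  moreover have "bounded (\<Union>n. ?F n)"
    using D(1)[of 0] dec[of 0] by - (rule bounded_subset[of "D 0"], auto simp: unb_def bounded_borel_def)
  ultimately have "(\<lambda>n. \<mu> (?F n)) sums \<mu> (\<Union>n. ?F n)"
    using \<mu>[unfolded additive_bb_def, rule_format, of ?F] by blast
  then have "(\<lambda>n. \<mu> (?F n)) \<longlonglongrightarrow> 0"
    using summable_LIMSEQ_zero sums_summable by blast
  then obtain n where "\<bar>\<mu> (?F n)\<bar> < 1"
    using LIMSEQ_D[of _ 0 1] by fastforce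
  then show False using D(3)[of n] by simp
qed

lemma pos_part_fun_finite:
  assumes "additive_bb \<mu>" "E \<in> bounded_borel"
  shows "pos_part_fun \<mu> E < \<infinity>"
proof -
  obtain c where "\<forall>B \<in> bounded_borel. B \<subseteq> E \<longrightarrow> \<bar>\<mu> B\<bar> \<le> c"
    using additive_bb_bounded[OF assms] by blast
  then have "pos_part_fun \<mu> E \<le> ennreal c"
    unfolding pos_part_fun_def by (intro SUP_least ennreal_leI) force
  then show ?thesis by (simp add: le_less_trans)
qed

lemma jordan_le:
  assumes \<mu>: "additive_bb \<mu>" and A: "A \<in> bounded_borel"
  shows "enn2real (pos_part_fun \<mu> A) \<le> \<mu> A + enn2real (pos_part_fun (\<lambda>A. - \<mu> A) A)"
proof -
  let ?n = "enn2real (pos_part_fun (\<lambda>A. - \<mu> A) A)"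
  have "pos_part_fun (\<lambda>A. - \<mu> A) A < \<infinity>"
    by (rule pos_part_fun_finite[OF additive_bb_minus[OF \<mu>] A])
  then have fin: "pos_part_fun (\<lambda>A. - \<mu> A) A = ennreal ?n"
    by simp
  have n: "- \<mu> B \<le> ?n" if "B \<in> bounded_borel" "B \<subseteq> A" for B
  proof -
    have "ennreal (- \<mu> B) \<le> ennreal ?n"
      using pos_part_fun_upper[OF that, of "\<lambda>A. - \<mu> A"] by (rule ord_le_eq_trans) (rule fin)
    then show ?thesis by (simp add: ennreal_le_iff)
  qed
  have "\<mu> B \<le> \<mu> A + ?n" if B: "B \<in> bounded_borel" "B \<subseteq> A" for B
  proof -
    have AB: "A - B \<in> bounded_borel"
      using A B(1) by - (rule bounded_borelI[of _ A], auto simp: bounded_borel_def)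
    have "\<mu> A = \<mu> B + \<mu> (A - B)"
      using additive_bb_Un[OF \<mu> B(1) AB] B(2) by (simp add: Un_absorb1)
    then show ?thesis using n[OF AB] by auto
  qed
  then have "pos_part_fun \<mu> A \<le> ennreal (\<mu> A + ?n)"
    unfolding pos_part_fun_def[of \<mu>] by (intro SUP_least ennreal_leI) auto
  moreover have "0 \<le> \<mu> A + ?n" using n[OF A] by simp
  ultimately show ?thesis by (simp add: enn2real_leI)
qed

lemma Jordan_decomposition:
  assumes "\<mu> \<in> M_loc" "A \<in> bounded_borel"
  shows "emeasure (pos_part \<mu>) A < \<infinity>" "emeasure (neg_part \<mu>) A < \<infinity>"
    and "\<mu> A = measure (pos_part \<mu>) A - measure (neg_part \<mu>) A"
proof -
  have \<mu>: "additive_bb \<mu>" and A: "A \<in> sets borel"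
    using assms by (auto simp: M_loc_additive bounded_borel_def)
  show "emeasure (pos_part \<mu>) A < \<infinity>" "emeasure (neg_part \<mu>) A < \<infinity>"
    unfolding emeasure_pos_part[OF \<mu> A] emeasure_neg_part[OF \<mu> A]
    by (intro pos_part_fun_finite additive_bb_minus \<mu> assms(2))+
  show "\<mu> A = measure (pos_part \<mu>) A - measure (neg_part \<mu>) A"
    unfolding measure_def emeasure_pos_part[OF \<mu> A] emeasure_neg_part[OF \<mu> A]
    using jordan_le[OF \<mu> assms(2)] jordan_le[OF additive_bb_minus[OF \<mu>] assms(2)] by simp
qed

end

theory Submission
  imports Defs "HOL-Probability.Distributions"
begin

text \<open>
  Everything rests on the elementary inequality \<open>|y|\<^sup>2 \<le> 2 |x|\<^sup>2 + 2 |x - y|\<^sup>2\<close>, which trades a Gaussian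
  centred at \<open>x\<close> for a Gaussian centred at the origin.

  Used as \<open>|x - y|\<^sup>2 \<ge> |y|\<^sup>2/2 - |x|\<^sup>2\<close>, it shows that the unnormalised heat kernel is at most
  \<open>e\<^bsup>|x|\<^sup>2/4t\<^esup> e\<^bsup>-|y|\<^sup>2/8t\<^esup>\<close>, and the membership of \<open>u\<^sub>0\<close> in \<open>M_eps (1/8t)\<close> makes this integrable in \<open>y\<close>
  (\<open>heat_defined_if_M_0\<close>). The bound is locally uniform in \<open>x\<close>, so dominated convergence
  makes \<open>u(t)\<close> continuous (\<open>continuous_heat\<close>), hence measurable and locally integrable.

  Used as \<open>\<delta> |x|\<^sup>2 + |x - y|\<^sup>2/4t \<ge> (m/2) |y|\<^sup>2\<close> with \<open>m = min \<delta> (1/4t)\<close>, the same inequality shows that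
  \<open>e\<^bsup>-\<delta>|x|\<^sup>2\<^esup> |u(x,t)|\<close> is bounded in \<open>x\<close>, for every \<open>\<delta> > 0\<close> (\<open>heat_growth\<close>). With \<open>\<delta> = \<epsilon>/2\<close> the remaining
  factor \<open>e\<^bsup>-\<epsilon>|x|\<^sup>2/2\<^esup>\<close> of the weight is Lebesgue integrable.
  This pointwise bound makes an interchange of the \<open>x\<close> and \<open>y\<close> integrals unnecessary.

  For the converse, \<open>\<integral> e\<^bsup>-\<epsilon>|y|\<^sup>2\<^esup> d|u\<^sub>0|(y)\<close> is exactly the integral whose finiteness is required for
  \<open>u(0,t)\<close> to be defined at time \<open>t = 1/4\<epsilon>\<close>.
\<close>

section \<open>Gaussian estimates\<close>

lemma norm_square_le_shift:
  fixes x y :: "'a::real_normed_vector"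
  shows "(norm y)\<^sup>2 \<le> 2 * (norm x)\<^sup>2 + 2 * (norm (x - y))\<^sup>2"
proof -
  have "norm y \<le> norm x + norm (x - y)"
    using norm_triangle_ineq4[of x "x - y"] by simp
  then have "(norm y)\<^sup>2 \<le> (norm x + norm (x - y))\<^sup>2"
    by (intro power_mono) auto
  also have "\<dots> \<le> 2 * (norm x)\<^sup>2 + 2 * (norm (x - y))\<^sup>2"
    using sum_squares_bound[of "norm x" "norm (x - y)"] by (simp add: power2_sum)
  finally show ?thesis .
qed

lemma heat_kernel_le_centred:
  fixes x y :: "'a::real_normed_vector"
  assumes "t > 0"
  shows "exp (- (norm (x - y))\<^sup>2 / (4 * t))
    \<le> exp ((norm x)\<^sup>2 / (4 * t)) * exp (- (1 / (8 * t)) * (norm y)\<^sup>2)"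
proof -
  have "- (norm (x - y))\<^sup>2 / (4 * t) \<le> (norm x)\<^sup>2 / (4 * t) + - (1 / (8 * t)) * (norm y)\<^sup>2"
    using norm_square_le_shift[of y x] assms by (simp add: field_simps)
  then show ?thesis by (simp flip: exp_add)
qed

lemma weighted_heat_kernel_le:
  fixes x y :: "'a::real_normed_vector"
  assumes "0 \<le> m" "m \<le> \<delta>" "m \<le> 1 / (4 * t)"
  shows "exp (- \<delta> * (norm x)\<^sup>2) * exp (- (norm (x - y))\<^sup>2 / (4 * t)) \<le> exp (- (m / 2) * (norm y)\<^sup>2)"
proof -
  have "m * (norm y)\<^sup>2 \<le> m * (2 * (norm x)\<^sup>2 + 2 * (norm (x - y))\<^sup>2)"
    using norm_square_le_shift assms(1) by (intro mult_left_mono)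
  moreover have "m * (norm x)\<^sup>2 \<le> \<delta> * (norm x)\<^sup>2" "m * (norm (x - y))\<^sup>2 \<le> 1 / (4 * t) * (norm (x - y))\<^sup>2"
    using assms by (intro mult_right_mono; simp)+
  ultimately have "- \<delta> * (norm x)\<^sup>2 + - (norm (x - y))\<^sup>2 / (4 * t) \<le> - (m / 2) * (norm y)\<^sup>2"
    by (simp add: algebra_simps)
  then show ?thesis by (simp flip: exp_add)
qed

text \<open>The Gaussian is a product over the coordinates, and in one dimension it is a multiple of the
  density of a centred normal distribution.\<close>

lemma nn_integral_gaussian_finite:
  assumes "a > 0"
  shows "(\<integral>\<^sup>+x. ennreal (exp (- a * (norm (x::'a::euclidean_space))\<^sup>2)) \<partial>lborel) < \<infinity>"
proof -
  \<comment> \<open>The standard deviation for which \<open>x\<^sup>2/(2 \<sigma>\<^sup>2) = a x\<^sup>2\<close>.\<close>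
  define \<sigma> where "\<sigma> = 1 / sqrt (2 * a)"
  have \<sigma>: "\<sigma> > 0" "2 * \<sigma>\<^sup>2 = 1 / a"
    using assms by (auto simp: \<sigma>_def power_divide)
  have "exp (- a * x\<^sup>2) = sqrt (2 * pi * \<sigma>\<^sup>2) * normal_density 0 \<sigma> x" for x
    using \<sigma> assms unfolding normal_density_def by (simp add: field_simps)
  then have "integrable lborel (\<lambda>x::real. exp (- a * x\<^sup>2))"
    using integrable_normal_density[OF \<sigma>(1), of 0] by simp
  then have line: "(\<integral>\<^sup>+x. ennreal (exp (- a * (x::real)\<^sup>2)) \<partial>lborel) < \<infinity>"
    by (simp add: integrable_iff_bounded)
  have "ennreal (exp (- a * (norm x)\<^sup>2)) = (\<Prod>b\<in>Basis. ennreal (exp (- a * (x \<bullet> b)\<^sup>2)))" for x :: 'a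
  proof -
    have "(norm x)\<^sup>2 = (\<Sum>b\<in>Basis. (x \<bullet> b)\<^sup>2)"
      unfolding power2_norm_eq_inner euclidean_inner[of x x] by (simp add: power2_eq_square)
    then show ?thesis
      by (simp add: prod_ennreal sum_distrib_left flip: exp_sum sum_negf)
  qed
  then have "(\<integral>\<^sup>+x. ennreal (exp (- a * (norm (x::'a))\<^sup>2)) \<partial>lborel)
      = (\<Prod>b\<in>(Basis::'a set). \<integral>\<^sup>+x. ennreal (exp (- a * x\<^sup>2)) \<partial>lborel)"
    by (simp only:) (rule nn_integral_lborel_prod, auto)
  also have "\<dots> < \<infinity>"
    using line by (simp add: power_less_top_ennreal)
  finally show ?thesis .
qed

section \<open>Heat evolution of measures with subgaussian growth\<close>

lemma pos_part_le_total_variation: "pos_part \<mu> \<le> total_variation \<mu>"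
  and neg_part_le_total_variation: "neg_part \<mu> \<le> total_variation \<mu>"
  by (auto simp: le_measure emeasure_total_variation)

lemma M_0_gaussian_integrable:
  assumes "\<mu> \<in> M_0" "\<epsilon> > 0"
  shows "integrable (total_variation \<mu>) (\<lambda>y. exp (- \<epsilon> * (norm y)\<^sup>2))"
  using assms by (auto simp: M_0_def M_eps_def integrable_iff_bounded)

lemma integrable_mono_measure:
  fixes f :: "'a \<Rightarrow> 'b::{banach, second_countable_topology}"
  assumes "integrable N f" "sets M = sets N" "M \<le> N"
  shows "integrable M f"
  using assms nn_integral_mono_measure[OF assms(2,3), of "\<lambda>x. ennreal (norm (f x))"]
    measurable_cong_sets[OF assms(2) refl, of borel]
  by (auto simp: integrable_iff_bounded)

lemma integral_mono_measure_nonneg: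
  fixes f :: "'a \<Rightarrow> real"
  assumes f: "integrable N f" and M: "sets M = sets N" "M \<le> N" and nonneg: "\<And>x. 0 \<le> f x"
  shows "integral\<^sup>L M f \<le> integral\<^sup>L N f"
proof -
  have "ennreal (integral\<^sup>L M f) \<le> ennreal (integral\<^sup>L N f)"
    using nn_integral_mono_measure[OF M, of "\<lambda>x. ennreal (f x)"]
    by (simp add: nn_integral_eq_integral f integrable_mono_measure[OF f M] nonneg)
  then show ?thesis
    using nonneg by (simp add: ennreal_le_iff)
qed

lemma heat_defined_if_M_0:
  assumes "\<mu> \<in> M_0" "t > 0"
  shows "heat_defined \<mu> x t"
  unfolding heat_defined_def
proof (rule Bochner_Integration.integrable_bound)
  show "integrable (total_variation \<mu>)
      (\<lambda>y. exp ((norm x)\<^sup>2 / (4 * t)) * exp (- (1 / (8 * t)) * (norm y)\<^sup>2))"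
    using assms by (intro integrable_mult_right M_0_gaussian_integrable) auto
qed (use heat_kernel_le_centred[OF assms(2)] in auto)

text \<open>The Jordan parts give two nonnegative numbers, each at most \<open>\<integral> f d|\<mu>|\<close>; so does their difference
  in modulus.\<close>

lemma abs_signed_integral_le:
  assumes "integrable (total_variation \<mu>) f" "\<And>x. 0 \<le> f x"
  shows "\<bar>signed_integral \<mu> f\<bar> \<le> (\<integral>y. f y \<partial>total_variation \<mu>)"
proof -
  have "(\<integral>y. f y \<partial>pos_part \<mu>) \<le> (\<integral>y. f y \<partial>total_variation \<mu>)"
    and "(\<integral>y. f y \<partial>neg_part \<mu>) \<le> (\<integral>y. f y \<partial>total_variation \<mu>)"
    using assms pos_part_le_total_variation neg_part_le_total_variation
    by (auto intro!: integral_mono_measure_nonneg)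
  moreover have "0 \<le> (\<integral>y. f y \<partial>pos_part \<mu>)" "0 \<le> (\<integral>y. f y \<partial>neg_part \<mu>)"
    using assms(2) by simp_all
  ultimately show ?thesis unfolding signed_integral_def by linarith
qed

text \<open>The kernel times \<open>e\<^bsup>-\<delta>|x|\<^sup>2\<^esup>\<close> lies below a Gaussian in \<open>y\<close> that does not depend on \<open>x\<close>; its
  integral against \<open>|\<mu>|\<close> gives the constant. Since \<open>\<delta>\<close> may be taken
  arbitrarily small, \<open>u(t)\<close> grows more slowly than every \<open>e\<^bsup>\<delta>|x|\<^sup>2\<^esup>\<close>.\<close>

lemma heat_growth:
  fixes \<mu> :: "'a::euclidean_space set \<Rightarrow> real"
  assumes \<mu>: "\<mu> \<in> M_0" and t: "t > 0" and \<delta>: "\<delta> > 0"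
  obtains C where "C \<ge> 0" "\<And>x. \<bar>heat \<mu> x t\<bar> \<le> C * exp (\<delta> * (norm x)\<^sup>2)"
proof -
  define m where "m = min \<delta> (1 / (4 * t))"
  define I where "I = (\<integral>y. exp (- (m / 2) * (norm y)\<^sup>2) \<partial>total_variation \<mu>)"
  define K where "K = 1 / (4 * pi * t) powr (DIM('a) / 2)"
  have m: "m > 0" "m \<le> \<delta>" "m \<le> 1 / (4 * t)" using t \<delta> by (auto simp: m_def)
  have K: "K \<ge> 0" by (simp add: K_def)
  have "\<bar>heat \<mu> x t\<bar> \<le> K * I * exp (\<delta> * (norm x)\<^sup>2)" for x
  proof -
    let ?k = "\<lambda>y. exp (- (norm (x - y))\<^sup>2 / (4 * t))"
    have k: "integrable (total_variation \<mu>) ?k"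
      using heat_defined_if_M_0[OF \<mu> t] unfolding heat_defined_def .
    have "exp (- \<delta> * (norm x)\<^sup>2) * (\<integral>y. ?k y \<partial>total_variation \<mu>)
        = (\<integral>y. exp (- \<delta> * (norm x)\<^sup>2) * ?k y \<partial>total_variation \<mu>)"
      by (rule integral_mult_right_zero[symmetric])
    also have "\<dots> \<le> I"
      unfolding I_def using k m \<mu>
      by (intro integral_mono weighted_heat_kernel_le M_0_gaussian_integrable
          integrable_mult_right) auto
    finally have "(\<integral>y. ?k y \<partial>total_variation \<mu>) \<le> I * exp (\<delta> * (norm x)\<^sup>2)"
      by (simp add: exp_minus field_simps)
    moreover have "\<bar>signed_integral \<mu> ?k\<bar> \<le> (\<integral>y. ?k y \<partial>total_variation \<mu>)"
      using k by (rule abs_signed_integral_le) simp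
    ultimately have "\<bar>signed_integral \<mu> ?k\<bar> \<le> I * exp (\<delta> * (norm x)\<^sup>2)" by linarith
    then have "K * \<bar>signed_integral \<mu> ?k\<bar> \<le> K * (I * exp (\<delta> * (norm x)\<^sup>2))"
      using K by (rule mult_left_mono)
    then show ?thesis
      using K unfolding heat_def K_def[symmetric] by (simp add: abs_mult mult.assoc)
  qed
  moreover have "I \<ge> 0" unfolding I_def by simp
  ultimately show ?thesis using that[of "K * I"] K by simp
qed

text \<open>Along a convergent sequence of points \<open>x\<close>, which stays in some ball of radius \<open>R\<close>, the kernels are
  dominated by the single function \<open>e\<^bsup>R\<^sup>2/4t\<^esup> e\<^bsup>-|y|\<^sup>2/8t\<^esup>\<close>.\<close>

lemma continuous_heat:
  fixes \<mu> :: "'a::euclidean_space set \<Rightarrow> real"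
  assumes \<mu>: "\<mu> \<in> M_0" and t: "t > 0"
  shows "continuous_on UNIV (\<lambda>x. heat \<mu> x t)"
proof -
  let ?k = "\<lambda>x y. exp (- (norm (x - y))\<^sup>2 / (4 * t))"
  have cont: "(\<lambda>n. \<integral>y. ?k (u n) y \<partial>M) \<longlonglongrightarrow> (\<integral>y. ?k a y \<partial>M)"
    if M: "sets M = sets borel" "M \<le> total_variation \<mu>" and u: "u \<longlonglongrightarrow> a"
    for M :: "'a measure" and u a
  proof -
    obtain R where R: "\<And>n. norm (u n) \<le> R"
      using convergent_imp_bounded[OF u] unfolding bounded_iff by auto
    note [measurable_cong] = M(1)
    show ?thesis
    proof (rule integral_dominated_convergence)
      show "integrable M (\<lambda>y. exp (R\<^sup>2 / (4 * t)) * exp (- (1 / (8 * t)) * (norm y)\<^sup>2))"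
        using t M by (intro integrable_mult_right integrable_mono_measure[OF
              M_0_gaussian_integrable[OF \<mu>]]) auto
      show "AE y in M. (\<lambda>n. ?k (u n) y) \<longlonglongrightarrow> ?k a y"
        using t by (intro AE_I2 tendsto_intros u) auto
      have "norm (?k (u n) y) \<le> exp (R\<^sup>2 / (4 * t)) * exp (- (1 / (8 * t)) * (norm y)\<^sup>2)" for n y
      proof -
        have "(norm (u n))\<^sup>2 \<le> R\<^sup>2" by (intro power_mono R) simp
        then have "exp ((norm (u n))\<^sup>2 / (4 * t)) \<le> exp (R\<^sup>2 / (4 * t))"
          using t by (simp add: divide_right_mono)
        then show ?thesis
          using heat_kernel_le_centred[OF t, of "u n" y]
          by (simp add: order_trans[OF _ mult_right_mono])
      qed
      then show "AE y in M. norm (?k (u n) y)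
          \<le> exp (R\<^sup>2 / (4 * t)) * exp (- (1 / (8 * t)) * (norm y)\<^sup>2)" for n
        by simp
    qed measurable
  qed
  show ?thesis
    unfolding heat_def signed_integral_def
    by (intro continuous_on_mult_left continuous_on_diff continuous_on_sequentiallyI cont
        pos_part_le_total_variation neg_part_le_total_variation) auto
qed

lemma continuous_imp_L1_loc:
  fixes f :: "'a::euclidean_space \<Rightarrow> real"
  assumes "continuous_on UNIV f"
  shows "f \<in> L1_loc"
  unfolding L1_loc_def
proof (intro CollectI allI impI)
  fix K :: "'a set" assume K: "compact K"
  have "integrable lborel (\<lambda>x. indicator K x *\<^sub>R f x)"
    using K continuous_on_subset[OF assms] by (intro borel_integrable_compact) auto
  then show "f absolutely_integrable_on K"
    by (simp add: set_integrable_def integrable_completion borel_measurable_integrable)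
qed

lemma heat_in_L1_0:
  fixes \<mu> :: "'a::euclidean_space set \<Rightarrow> real"
  assumes \<mu>: "\<mu> \<in> M_0" and t: "t > 0"
  shows "(\<lambda>x. heat \<mu> x t) \<in> L1_0"
proof -
  have "(\<integral>\<^sup>+x. ennreal (exp (- \<epsilon> * (norm x)\<^sup>2) * \<bar>heat \<mu> x t\<bar>) \<partial>lebesgue) < \<infinity>" if \<epsilon>: "\<epsilon> > 0" for \<epsilon>
  proof -
    \<comment> \<open>One half of the weight absorbs the growth of \<open>u(t)\<close>; the other half is integrable.\<close>
    obtain C where C: "C \<ge> 0" "\<And>x. \<bar>heat \<mu> x t\<bar> \<le> C * exp (\<epsilon> / 2 * (norm x)\<^sup>2)"
      using heat_growth[OF \<mu> t, of "\<epsilon> / 2"] \<epsilon> by auto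
    have "exp (- \<epsilon> * (norm x)\<^sup>2) * \<bar>heat \<mu> x t\<bar> \<le> C * exp (- (\<epsilon> / 2) * (norm x)\<^sup>2)" for x
    proof -
      have "exp (- \<epsilon> * (norm x)\<^sup>2) * \<bar>heat \<mu> x t\<bar>
          \<le> exp (- \<epsilon> * (norm x)\<^sup>2) * (C * exp (\<epsilon> / 2 * (norm x)\<^sup>2))"
        by (intro mult_left_mono C) simp
      also have "\<dots> = C * exp (- \<epsilon> * (norm x)\<^sup>2 + \<epsilon> / 2 * (norm x)\<^sup>2)"
        by (simp only: exp_add mult_ac)
      also have "- \<epsilon> * (norm x)\<^sup>2 + \<epsilon> / 2 * (norm x)\<^sup>2 = - (\<epsilon> / 2) * (norm x)\<^sup>2"
        by (simp add: field_simps)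
      finally show ?thesis .
    qed
    then have "(\<integral>\<^sup>+x. ennreal (exp (- \<epsilon> * (norm x)\<^sup>2) * \<bar>heat \<mu> x t\<bar>) \<partial>lebesgue)
        \<le> (\<integral>\<^sup>+x. ennreal C * ennreal (exp (- (\<epsilon> / 2) * (norm (x::'a))\<^sup>2)) \<partial>lborel)"
      unfolding nn_integral_completion
      by (intro nn_integral_mono) (simp add: C(1) ennreal_leI flip: ennreal_mult)
    also have "\<dots> = ennreal C * (\<integral>\<^sup>+x. ennreal (exp (- (\<epsilon> / 2) * (norm (x::'a))\<^sup>2)) \<partial>lborel)"
      by (rule nn_integral_cmult) simp
    also have "\<dots> < \<infinity>"
      using nn_integral_gaussian_finite[where 'a = 'a, of "\<epsilon> / 2"] \<epsilon> by (simp add: ennreal_mult_less_top)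
    finally show ?thesis .
  qed
  then show ?thesis
    using continuous_imp_L1_loc[OF continuous_heat[OF \<mu> t]] by (simp add: L1_0_def L1_eps_def)
qed

section \<open>The class of admissible initial data\<close>

lemma M_0_if_heat_defined_at_origin:
  assumes "\<mu> \<in> M_loc" "\<And>t. t > 0 \<Longrightarrow> heat_defined \<mu> 0 t"
  shows "\<mu> \<in> M_0"
proof -
  have "(\<integral>\<^sup>+x. ennreal (exp (- \<epsilon> * (norm x)\<^sup>2)) \<partial>total_variation \<mu>) < \<infinity>" if "\<epsilon> > 0" for \<epsilon>
    \<comment> \<open>For this \<open>t\<close>, \<open>1/(4t) = \<epsilon>\<close>.\<close>
    using assms(2)[of "1 / (4 * \<epsilon>)"] that
    by (simp add: heat_defined_def integrable_iff_bounded mult.commute)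
  then show ?thesis using assms(1) by (simp add: M_0_def M_eps_def)
qed

theorem proposition5p1:
  fixes u0 :: "(real ^ 'n) set \<Rightarrow> real"
  shows "(u0 \<in> M_0 \<longrightarrow>
            (\<forall>x. \<forall>t>0. heat_defined u0 x t) \<and>
            (\<forall>t>0. (\<lambda>x. heat u0 x t) \<in> L1_0))
       \<and> (u0 \<in> M_loc \<and> nonneg_measure u0 \<and> (\<forall>x. \<forall>t>0. heat_defined u0 x t)
            \<longrightarrow> u0 \<in> M_0)"
  using heat_defined_if_M_0 heat_in_L1_0 M_0_if_heat_defined_at_origin by blast

end
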